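(* Let $f:\mathcal{C}(1)\to\mathcal{C}(2)$ be a morphism of regular exact couples of $R$-modules (with bidegrees $\mathbf{a},\mathbf{b},\mathbf{c}$, and $\sigma=\det[\mathbf{a}\ (\mathbf{b}+\mathbf{c})]$) such that for a given $n\in\mathbb{Z}$ the objects $E^\infty_{\mathbf{x}(n)+\mathbf{b}+r\mathbf{a}}(s)$ are stable for all $r\in\mathbb{Z}$ and $s=1,2$. Suppose the following hold: (i) $f$ induces epimorphisms $E^\infty_{\mathbf{x}(n)+\mathbf{b}+r\mathbf{a}}(1)\to E^\infty_{\mathbf{x}(n)+\mathbf{b}+r\mathbf{a}}(2)$ for all $r\in\mathbb{Z}$. (ii) $L_{n+\sigma}(1)=0=L_{n+\sigma}(2)$. (iii) The structure maps $i$ of the diagram $r\mapsto D_{\mathbf{x}(n)+\mathbf{b}+\mathbf{c}+r\mathbf{a}}(1)$ have kernels satisfying the descending chain condition (on submodules). Then $f$ induces an epimorphism $L^{n+\sigma}(1)\to L^{n+\sigma}(2)$.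
   Context: $R$ is a unital ring. A $(\mathbb{Z}\times\mathbb{Z})$-bigraded exact couple $(E,D,i,j,k)$ with bidegrees $\mathbf{a},\mathbf{b},\mathbf{c}\in\mathbb{Z}\times\mathbb{Z}$ consists of families of $R$-modules $D_{\mathbf{x}},E_{\mathbf{x}}$ ($\mathbf{x}\in\mathbb{Z}\times\mathbb{Z}$) and $R$-linear maps $i_{\mathbf{x}}:D_{\mathbf{x}}\to D_{\mathbf{x}+\mathbf{a}}$, $j_{\mathbf{x}}:D_{\mathbf{x}}\to E_{\mathbf{x}+\mathbf{b}}$, $k_{\mathbf{x}}:E_{\mathbf{x}}\to D_{\mathbf{x}+\mathbf{c}}$ such that $D_{\mathbf{x}-\mathbf{a}}\xrightarrow{i}D_{\mathbf{x}}\xrightarrow{j}E_{\mathbf{x}+\mathbf{b}}\xrightarrow{k}D_{\mathbf{x}+\mathbf{b}+\mathbf{c}}\xrightarrow{i}D_{\mathbf{x}+\mathbf{a}+\mathbf{b}+\mathbf{c}}$ is exact for all $\mathbf{x}$. It is regular if $\sigma:=\det[\mathbf{a}\ (\mathbf{b}+\mathbf{c})]\in\{1,-1\}$. A morphism of exact couples with equal bidegrees is a pair of families $D_{\mathbf{x}}(1)\to D_{\mathbf{x}}(2)$, $E_{\mathbf{x}}(1)\to E_{\mathbf{x}}(2)$ of $R$-linear maps commuting with $i,j,k$. Put $\mathbf{x}(m)=\sigma m(\mathbf{b}+\mathbf{c})$ for $m\in\mathbb{Z}$ (so $\mathbf{x}(n+\sigma)=\mathbf{x}(n)+\mathbf{b}+\mathbf{c}$).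 Let $D(m)$ be the diagram $r\mapsto D_{\mathbf{x}(m)+r\mathbf{a}}$ ($r\in\mathbb{Z}$, structure maps $i$); it consists of all $D_{\mathbf{x}}$ with $\det[\mathbf{a}\ \mathbf{x}]=m$. Then $L_m:=\operatorname{colim}D(m)$ and $L^m:=\lim D(m)$. With $i^r_{\mathbf{x}}:D_{\mathbf{x}}\to D_{\mathbf{x}+r\mathbf{a}}$ the $r$-fold composite of $i$: $Z^r_{\mathbf{x}+\mathbf{b}}=k^{-1}(\operatorname{im}\,i^r_{\mathbf{x}+\mathbf{b}+\mathbf{c}-r\mathbf{a}})$, $B^r_{\mathbf{x}+\mathbf{b}}=j(\ker i^r_{\mathbf{x}})$, $B^\infty=\bigcup_rB^r$, $E^\infty_{\mathbf{x}+\mathbf{b}}=\bigcap_rZ^r_{\mathbf{x}+\mathbf{b}}/B^\infty_{\mathbf{x}+\mathbf{b}}$. For ordinals $\tau$ let $I^0_{\mathbf{x}}=D_{\mathbf{x}}$, $I^{\tau+1}_{\mathbf{x}}=i(I^\tau_{\mathbf{x}-\mathbf{a}})$, and intersections at limit ordinals; let $\bar{I}_{\mathbf{x}}$ be the value of $I^\tau_{\mathbf{x}}$ for all sufficiently large $\tau$. The stable $E$-object is $\bar{E}_{\mathbf{x}+\mathbf{b}}=k^{-1}(\bar{I}_{\mathbf{x}+\mathbf{b}+\mathbf{c}})/B^\infty_{\mathbf{x}+\mathbf{b}}\subseteq E^\infty_{\mathbf{x}+\mathbf{b}}$, and $E^\infty_{\mathbf{x}+\mathbf{b}}$ is called stable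 if this inclusion is an equality. *)

theory Defs
  imports "HOL-Algebra.Module" "HOL-Algebra.AbelCoset" "HOL-Library.Product_Plus"
begin

section \<open>Left modules over a unital ring\<close>

text \<open>
  The library locale \<open>module\<close> is restricted to commutative rings; here the ring is an arbitrary
  unital ring. The record type \<open>('r, 'm) module\<close> is reused; its multiplicative fields carry no
  meaning for a module and are left unspecified in the constructions below.
\<close>

locale left_module = R?: ring R + M?: abelian_group M
  for R (structure) and M :: "('r, 'm, 'z) module_scheme" (structure) +
  assumes smult_closed:
      "\<lbrakk>a \<in> carrier R; x \<in> carrier M\<rbrakk> \<Longrightarrow> a \<odot>\<^bsub>M\<^esub> x \<in> carrier M"
    and smult_l_distr:
      "\<lbrakk>a \<in> carrier R; b \<in> carrier R; x \<in> carrier M\<rbrakk> \<Longrightarrow>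
        (a \<oplus>\<^bsub>R\<^esub> b) \<odot>\<^bsub>M\<^esub> x = a \<odot>\<^bsub>M\<^esub> x \<oplus>\<^bsub>M\<^esub> b \<odot>\<^bsub>M\<^esub> x"
    and smult_r_distr:
      "\<lbrakk>a \<in> carrier R; x \<in> carrier M; y \<in> carrier M\<rbrakk> \<Longrightarrow>
        a \<odot>\<^bsub>M\<^esub> (x \<oplus>\<^bsub>M\<^esub> y) = a \<odot>\<^bsub>M\<^esub> x \<oplus>\<^bsub>M\<^esub> a \<odot>\<^bsub>M\<^esub> y"
    and smult_assoc:
      "\<lbrakk>a \<in> carrier R; b \<in> carrier R; x \<in> carrier M\<rbrakk> \<Longrightarrow>
        (a \<otimes>\<^bsub>R\<^esub> b) \<odot>\<^bsub>M\<^esub> x = a \<odot>\<^bsub>M\<^esub> (b \<odot>\<^bsub>M\<^esub> x)"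
    and smult_one:
      "x \<in> carrier M \<Longrightarrow> \<one>\<^bsub>R\<^esub> \<odot>\<^bsub>M\<^esub> x = x"

definition linear_maps ::
  "('r, 'q) ring_scheme \<Rightarrow> ('r, 'm) module \<Rightarrow> ('r, 'n) module \<Rightarrow> ('m \<Rightarrow> 'n) set" where
  "linear_maps R M N =
    {h. h \<in> carrier M \<rightarrow> carrier N \<and>
        (\<forall>x\<in>carrier M. \<forall>y\<in>carrier M. h (x \<oplus>\<^bsub>M\<^esub> y) = h x \<oplus>\<^bsub>N\<^esub> h y) \<and>
        (\<forall>s\<in>carrier R. \<forall>x\<in>carrier M. h (s \<odot>\<^bsub>M\<^esub> x) = s \<odot>\<^bsub>N\<^esub> h x)}"

definition module_epi ::
  "('r, 'q) ring_scheme \<Rightarrow> ('r, 'm) module \<Rightarrow> ('r, 'n) module \<Rightarrow> ('m \<Rightarrow> 'n) set" where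
  "module_epi R M N = {h \<in> linear_maps R M N. h ` carrier M = carrier N}"

definition zero_module :: "('r, 'm) module \<Rightarrow> bool" where
  "zero_module M \<longleftrightarrow> carrier M = {\<zero>\<^bsub>M\<^esub>}"

definition dcc_module :: "('r, 'q) ring_scheme \<Rightarrow> ('r, 'm) module \<Rightarrow> bool" where
  "dcc_module R M \<longleftrightarrow>
    (\<forall>N :: nat \<Rightarrow> 'm set. (\<forall>k. submodule (N k) R M) \<and> (\<forall>k. N (Suc k) \<subseteq> N k) \<longrightarrow>
      (\<exists>k0. \<forall>k\<ge>k0. N k = N k0))"

text \<open>The module \<open>Z / B\<close> for submodules \<open>B \<subseteq> Z\<close> of \<open>M\<close>; its elements are the cosets \<open>B + z\<close>.\<close>

definition subquotient :: "('r, 'm) module \<Rightarrow> 'm set \<Rightarrow> 'm set \<Rightarrow> ('r, 'm set) module" where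
  "subquotient M Z B =
    \<lparr>carrier = (\<lambda>z. B +>\<^bsub>M\<^esub> z) ` Z, mult = undefined, one = undefined,
     zero = B, add = (\<lambda>X Y. X <+>\<^bsub>M\<^esub> Y),
     smult = (\<lambda>s X. \<Union>x\<in>X. B +>\<^bsub>M\<^esub> (s \<odot>\<^bsub>M\<^esub> x))\<rparr>"

text \<open>The map of subquotients induced by \<open>h\<close>, sending a coset of \<open>z\<close> to \<open>B + h z\<close>, where \<open>B\<close> is the
  denominator of the codomain; all members of a coset yield the same value.\<close>

definition subquotient_map :: "('r, 'n) module \<Rightarrow> 'n set \<Rightarrow> ('m \<Rightarrow> 'n) \<Rightarrow> 'm set \<Rightarrow> 'n set" where
  "subquotient_map N B h X = (\<Union>x\<in>X. B +>\<^bsub>N\<^esub> h x)"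


section \<open>Limits and colimits of diagrams indexed by the integers\<close>

text \<open>A diagram is given by modules \<open>M r\<close> and structure maps \<open>t r\<close> from \<open>M r\<close> to \<open>M (r + 1)\<close>;
  \<open>transition t r k\<close> is the composite from \<open>M r\<close> to \<open>M (r + k)\<close>.\<close>

primrec transition :: "(int \<Rightarrow> 'm \<Rightarrow> 'm) \<Rightarrow> int \<Rightarrow> nat \<Rightarrow> 'm \<Rightarrow> 'm" where
  "transition t r 0 = id"
| "transition t r (Suc k) = t (r + int k) \<circ> transition t r k"

definition colim_rel ::
  "(int \<Rightarrow> ('r, 'm) module) \<Rightarrow> (int \<Rightarrow> 'm \<Rightarrow> 'm) \<Rightarrow> ((int \<times> 'm) \<times> (int \<times> 'm)) set" where
  "colim_rel M t =
    {((r, d), (s, e)) | r d s e. d \<in> carrier (M r) \<and> e \<in> carrier (M s) \<and>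
      (\<exists>k l. r + int k = s + int l \<and> transition t r k d = transition t s l e)}"

text \<open>Sums of classes are computed by moving both representatives to the later index; note that
  \<open>nat\<close> truncates negative differences to \<open>0\<close>.\<close>

definition colim_module ::
  "(int \<Rightarrow> ('r, 'm) module) \<Rightarrow> (int \<Rightarrow> 'm \<Rightarrow> 'm) \<Rightarrow> ('r, (int \<times> 'm) set) module" where
  "colim_module M t =
    \<lparr>carrier = (SIGMA r:UNIV. carrier (M r)) // colim_rel M t,
     mult = undefined, one = undefined,
     zero = colim_rel M t `` {(0, \<zero>\<^bsub>M 0\<^esub>)},
     add = (\<lambda>X Y. \<Union>(r, d)\<in>X. \<Union>(s, e)\<in>Y.
       colim_rel M t `` {(max r s,
         transition t r (nat (s - r)) d \<oplus>\<^bsub>M (max r s)\<^esub> transition t s (nat (r - s)) e)}),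
     smult = (\<lambda>u X. \<Union>(r, d)\<in>X. colim_rel M t `` {(r, u \<odot>\<^bsub>M r\<^esub> d)})\<rparr>"

definition lim_module ::
  "(int \<Rightarrow> ('r, 'm) module) \<Rightarrow> (int \<Rightarrow> 'm \<Rightarrow> 'm) \<Rightarrow> ('r, int \<Rightarrow> 'm) module" where
  "lim_module M t =
    \<lparr>carrier = {v. (\<forall>r. v r \<in> carrier (M r)) \<and> (\<forall>r. t r (v r) = v (r + 1))},
     mult = undefined, one = undefined,
     zero = (\<lambda>r. \<zero>\<^bsub>M r\<^esub>),
     add = (\<lambda>v w r. v r \<oplus>\<^bsub>M r\<^esub> w r),
     smult = (\<lambda>u v r. u \<odot>\<^bsub>M r\<^esub> v r)\<rparr>"


section \<open>Bigraded exact couples\<close>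

definition zmult :: "int \<Rightarrow> int \<times> int \<Rightarrow> int \<times> int" (infixr \<open>\<cdot>\<close> 75) where
  "m \<cdot> v = (m * fst v, m * snd v)"

text \<open>The determinant of the matrix with columns \<open>u\<close> and \<open>v\<close>.\<close>

definition det2 :: "int \<times> int \<Rightarrow> int \<times> int \<Rightarrow> int" where
  "det2 u v = fst u * snd v - fst v * snd u"

text \<open>The map \<open>imap C x\<close> goes from \<open>Dob C x\<close> to \<open>Dob C (x + deg_i C)\<close>, and similarly for the
  other two: the index is always that of the domain.\<close>

record ('r, 'd, 'e) couple =
  deg_i :: "int \<times> int"
  deg_j :: "int \<times> int"
  deg_k :: "int \<times> int"
  Dob :: "int \<times> int \<Rightarrow> ('r, 'd) module"
  Eob :: "int \<times> int \<Rightarrow> ('r, 'e) module"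
  imap :: "int \<times> int \<Rightarrow> 'd \<Rightarrow> 'd"
  jmap :: "int \<times> int \<Rightarrow> 'd \<Rightarrow> 'e"
  kmap :: "int \<times> int \<Rightarrow> 'e \<Rightarrow> 'd"

definition exact_couple :: "('r, 'q) ring_scheme \<Rightarrow> ('r, 'd, 'e) couple \<Rightarrow> bool" where
  "exact_couple R C \<longleftrightarrow>
    (let a = deg_i C; b = deg_j C; c = deg_k C in
      ring R \<and>
      (\<forall>x. left_module R (Dob C x) \<and> left_module R (Eob C x)) \<and>
      (\<forall>x. imap C x \<in> linear_maps R (Dob C x) (Dob C (x + a))) \<and>
      (\<forall>x. jmap C x \<in> linear_maps R (Dob C x) (Eob C (x + b))) \<and>
      (\<forall>x. kmap C x \<in> linear_maps R (Eob C x) (Dob C (x + c))) \<and>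
      (\<forall>x. imap C (x - a) ` carrier (Dob C (x - a))
             = a_kernel (Dob C x) (Eob C (x + b)) (jmap C x)) \<and>
      (\<forall>x. jmap C x ` carrier (Dob C x)
             = a_kernel (Eob C (x + b)) (Dob C (x + b + c)) (kmap C (x + b))) \<and>
      (\<forall>x. kmap C (x + b) ` carrier (Eob C (x + b))
             = a_kernel (Dob C (x + b + c)) (Dob C (x + a + b + c)) (imap C (x + b + c))))"

definition couple_sign :: "('r, 'd, 'e) couple \<Rightarrow> int" where
  "couple_sign C = det2 (deg_i C) (deg_j C + deg_k C)"

definition regular_exact_couple :: "('r, 'q) ring_scheme \<Rightarrow> ('r, 'd, 'e) couple \<Rightarrow> bool" where
  "regular_exact_couple R C \<longleftrightarrow> exact_couple R C \<and> couple_sign C \<in> {1, -1}"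

definition couple_morphism ::
  "('r, 'q) ring_scheme \<Rightarrow> ('r, 'd1, 'e1) couple \<Rightarrow> ('r, 'd2, 'e2) couple \<Rightarrow>
    (int \<times> int \<Rightarrow> 'd1 \<Rightarrow> 'd2) \<Rightarrow> (int \<times> int \<Rightarrow> 'e1 \<Rightarrow> 'e2) \<Rightarrow> bool" where
  "couple_morphism R C1 C2 fD fE \<longleftrightarrow>
    deg_i C1 = deg_i C2 \<and> deg_j C1 = deg_j C2 \<and> deg_k C1 = deg_k C2 \<and>
    (\<forall>x. fD x \<in> linear_maps R (Dob C1 x) (Dob C2 x)) \<and>
    (\<forall>x. fE x \<in> linear_maps R (Eob C1 x) (Eob C2 x)) \<and>
    (\<forall>x. \<forall>d\<in>carrier (Dob C1 x). fD (x + deg_i C1) (imap C1 x d) = imap C2 x (fD x d)) \<and>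
    (\<forall>x. \<forall>d\<in>carrier (Dob C1 x). fE (x + deg_j C1) (jmap C1 x d) = jmap C2 x (fD x d)) \<and>
    (\<forall>x. \<forall>e\<in>carrier (Eob C1 x). fD (x + deg_k C1) (kmap C1 x e) = kmap C2 x (fE x e))"

definition base_point :: "('r, 'd, 'e) couple \<Rightarrow> int \<Rightarrow> int \<times> int" where
  "base_point C m = (couple_sign C * m) \<cdot> (deg_j C + deg_k C)"

definition D_diagram :: "('r, 'd, 'e) couple \<Rightarrow> int \<Rightarrow> int \<Rightarrow> ('r, 'd) module" where
  "D_diagram C m r = Dob C (base_point C m + r \<cdot> deg_i C)"

definition D_structure :: "('r, 'd, 'e) couple \<Rightarrow> int \<Rightarrow> int \<Rightarrow> 'd \<Rightarrow> 'd" where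
  "D_structure C m r = imap C (base_point C m + r \<cdot> deg_i C)"

definition couple_colim :: "('r, 'd, 'e) couple \<Rightarrow> int \<Rightarrow> ('r, (int \<times> 'd) set) module" where
  "couple_colim C m = colim_module (D_diagram C m) (D_structure C m)"

definition couple_lim :: "('r, 'd, 'e) couple \<Rightarrow> int \<Rightarrow> ('r, int \<Rightarrow> 'd) module" where
  "couple_lim C m = lim_module (D_diagram C m) (D_structure C m)"

definition couple_lim_map ::
  "('r, 'd, 'e) couple \<Rightarrow> (int \<times> int \<Rightarrow> 'd \<Rightarrow> 'd2) \<Rightarrow> int \<Rightarrow> (int \<Rightarrow> 'd) \<Rightarrow> (int \<Rightarrow> 'd2)" where
  "couple_lim_map C fD m v = (\<lambda>r. fD (base_point C m + r \<cdot> deg_i C) (v r))"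


section \<open>The limit page and the stable page\<close>

definition i_iter :: "('r, 'd, 'e) couple \<Rightarrow> nat \<Rightarrow> int \<times> int \<Rightarrow> 'd \<Rightarrow> 'd" where
  "i_iter C r x = transition (\<lambda>s. imap C (x + s \<cdot> deg_i C)) 0 r"

text \<open>Below, \<open>y\<close> is the bidegree of the \<open>E\<close>-object, so \<open>y = x + deg_j C\<close>.\<close>

definition cycles :: "('r, 'd, 'e) couple \<Rightarrow> nat \<Rightarrow> int \<times> int \<Rightarrow> 'e set" where
  "cycles C r y = {e \<in> carrier (Eob C y).
    kmap C y e \<in> i_iter C r (y + deg_k C - int r \<cdot> deg_i C) `
      carrier (Dob C (y + deg_k C - int r \<cdot> deg_i C))}"

definition boundaries :: "('r, 'd, 'e) couple \<Rightarrow> nat \<Rightarrow> int \<times> int \<Rightarrow> 'e set" where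
  "boundaries C r y = jmap C (y - deg_j C) `
    a_kernel (Dob C (y - deg_j C)) (Dob C (y - deg_j C + int r \<cdot> deg_i C))
      (i_iter C r (y - deg_j C))"

definition boundaries_inf :: "('r, 'd, 'e) couple \<Rightarrow> int \<times> int \<Rightarrow> 'e set" where
  "boundaries_inf C y = (\<Union>r. boundaries C r y)"

definition E_inf :: "('r, 'd, 'e) couple \<Rightarrow> int \<times> int \<Rightarrow> ('r, 'e set) module" where
  "E_inf C y = subquotient (Eob C y) (\<Inter>r. cycles C r y) (boundaries_inf C y)"

definition E_inf_map ::
  "('r, 'd2, 'e2) couple \<Rightarrow> (int \<times> int \<Rightarrow> 'e1 \<Rightarrow> 'e2) \<Rightarrow> int \<times> int \<Rightarrow> 'e1 set \<Rightarrow> 'e2 set" where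
  "E_inf_map C2 fE y = subquotient_map (Eob C2 y) (boundaries_inf C2 y) (fE y)"

text \<open>The transfinite image filtration along a well-order \<open>w\<close>, whose elements serve as ordinals.\<close>

definition is_successor :: "'o rel \<Rightarrow> 'o \<Rightarrow> 'o \<Rightarrow> bool" where
  "is_successor w \<rho> \<tau> \<longleftrightarrow> \<rho> \<in> underS w \<tau> \<and> underS w \<tau> = under w \<rho>"

definition image_stage ::
  "'o rel \<Rightarrow> ('r, 'd, 'e) couple \<Rightarrow> 'o \<Rightarrow> int \<times> int \<Rightarrow> 'd set" where
  "image_stage w C = wo_rel.worec w (\<lambda>I \<tau> x.
     if underS w \<tau> = {} then carrier (Dob C x)
     else if \<exists>\<rho>. is_successor w \<rho> \<tau>
       then imap C (x - deg_i C) ` I (THE \<rho>. is_successor w \<rho> \<tau>) (x - deg_i C)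
     else \<Inter>\<rho>\<in>underS w \<tau>. I \<rho> x)"

text \<open>
  A strictly decreasing sequence of stages is strictly shorter than the cardinal successor of the
  cardinality of \<open>int \<times> int \<times> 'd\<close>. Hence the initial well-order on the power set of this type
  is long enough to see all ordinals relevant to the filtration.
\<close>

definition filtration_ordinals :: "(int \<times> int \<times> 'd) set rel" where
  "filtration_ordinals = card_of UNIV"

text \<open>The relevant value exists and is unique, see \<open>stable_image_exists\<close> below.\<close>

definition stable_image :: "('r, 'd, 'e) couple \<Rightarrow> int \<times> int \<Rightarrow> 'd set" where
  "stable_image C x = (THE S. \<exists>\<tau>\<^sub>0. \<forall>\<tau>. (\<tau>\<^sub>0, \<tau>) \<in> (filtration_ordinals :: (int \<times> int \<times> 'd) set rel) \<longrightarrow>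
     image_stage filtration_ordinals C \<tau> x = S)"

lemma the_successor:
  assumes "Well_order w" "is_successor w \<rho> \<tau>"
  shows "(THE \<rho>. is_successor w \<rho> \<tau>) = \<rho>"
proof (rule the_equality)
  interpret wo_rel w using assms by (simp add: wo_rel_def)
  fix \<rho>' assume "is_successor w \<rho>' \<tau>"
  with assms(2) have "(\<rho>, \<rho>') \<in> w" "(\<rho>', \<rho>) \<in> w"
    unfolding is_successor_def under_def by blast+
  then show "\<rho>' = \<rho>" using ANTISYM by (auto simp: antisym_def)
qed (rule assms(2))

lemma image_stage_unfold:
  fixes w :: "'o rel" and C :: "('r, 'd, 'e) couple"
  assumes "Well_order w"
  shows "image_stage w C \<tau> x =
    (if underS w \<tau> = {} then carrier (Dob C x)
     else if \<exists>\<rho>. is_successor w \<rho> \<tau>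
       then imap C (x - deg_i C) ` image_stage w C (THE \<rho>. is_successor w \<rho> \<tau>) (x - deg_i C)
     else \<Inter>\<rho>\<in>underS w \<tau>. image_stage w C \<rho> x)"
proof -
  interpret wo_rel w using assms by (simp add: wo_rel_def)
  define H where "H = (\<lambda>I \<tau> x.
     if underS \<tau> = {} then carrier (Dob C x)
     else if \<exists>\<rho>. is_successor w \<rho> \<tau>
       then imap C (x - deg_i C) ` I (THE \<rho>. is_successor w \<rho> \<tau>) (x - deg_i C)
     else \<Inter>\<rho>\<in>underS \<tau>. I \<rho> x)"
  have "adm_wo H"
    unfolding adm_wo_def
  proof (intro allI impI ext)
    fix f g :: "'o \<Rightarrow> int \<times> int \<Rightarrow> 'd set" and \<tau> x assume eq: "\<forall>\<rho>\<in>underS \<tau>. f \<rho> = g \<rho>"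
    have "f (THE \<rho>. is_successor w \<rho> \<tau>) = g (THE \<rho>. is_successor w \<rho> \<tau>)"
      if "is_successor w \<rho> \<tau>" for \<rho>
    proof -
      from that have "\<rho> \<in> underS \<tau>" unfolding is_successor_def by (rule conjunct1)
      with eq show ?thesis unfolding the_successor[OF assms that] by blast
    qed
    with eq show "H f \<tau> x = H g \<tau> x" by (auto simp: H_def)
  qed
  then have "worec H = H (worec H)" by (rule worec_fixpoint)
  moreover have "image_stage w C = worec H" by (simp add: image_stage_def H_def)
  ultimately have "image_stage w C \<tau> x = H (image_stage w C) \<tau> x" by metis
  then show ?thesis by (simp add: H_def)
qed

lemma image_stage_successor:
  assumes "Well_order w" "is_successor w \<rho> \<tau>"
  shows "image_stage w C \<tau> x = imap C (x - deg_i C) ` image_stage w C \<rho> (x - deg_i C)"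
proof -
  interpret wo_rel w using assms by (simp add: wo_rel_def)
  note the_successor[OF assms]
  moreover have "underS \<tau> \<noteq> {}" "\<exists>\<rho>. is_successor w \<rho> \<tau>"
    using assms(2) by (auto simp: is_successor_def)
  ultimately show ?thesis by (simp add: image_stage_unfold[OF assms(1), of C \<tau> x])
qed

lemma image_stage_shift:
  assumes wo: "Well_order w" and cl: "\<And>x. imap C x ` carrier (Dob C x) \<subseteq> carrier (Dob C (x + deg_i C))"
  shows "imap C (x - deg_i C) ` image_stage w C \<tau> (x - deg_i C) \<subseteq> image_stage w C \<tau> x"
proof -
  interpret wo_rel w using wo by (simp add: wo_rel_def)
  show ?thesis
  proof (induction \<tau> arbitrary: x rule: well_order_induct)
    case (1 \<tau>)
    consider (zero) "underS \<tau> = {}" | (succ) \<rho> where "is_successor w \<rho> \<tau>"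
      | (lim) "underS \<tau> \<noteq> {}" "\<not> (\<exists>\<rho>. is_successor w \<rho> \<tau>)" by blast
    then show ?case
    proof cases
      case zero
      then show ?thesis using cl[of "x - deg_i C"] by (simp add: image_stage_unfold[OF wo])
    next
      case succ
      then have "\<rho> \<noteq> \<tau>" "(\<rho>, \<tau>) \<in> w" by (auto simp: is_successor_def underS_def)
      with 1 have "imap C (x - deg_i C - deg_i C) ` image_stage w C \<rho> (x - deg_i C - deg_i C)
          \<subseteq> image_stage w C \<rho> (x - deg_i C)" by blast
      then show ?thesis
        unfolding image_stage_successor[OF wo succ] by (rule image_mono)
    next
      case lim
      have "imap C (x - deg_i C) ` image_stage w C \<rho> (x - deg_i C) \<subseteq> image_stage w C \<rho> x"
        if "\<rho> \<in> underS \<tau>" for \<rho>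
        using 1[rule_format, of \<rho> x] that unfolding underS_def by blast
      moreover have "image_stage w C \<tau> y = (\<Inter>\<rho>\<in>underS \<tau>. image_stage w C \<rho> y)" for y
        using lim by (subst image_stage_unfold[OF wo]) simp
      ultimately show ?thesis by blast
    qed
  qed
qed

lemma image_stage_antimono:
  assumes wo: "Well_order w" and cl: "\<And>x. imap C x ` carrier (Dob C x) \<subseteq> carrier (Dob C (x + deg_i C))"
    and le: "(\<rho>, \<tau>) \<in> w"
  shows "image_stage w C \<tau> x \<subseteq> image_stage w C \<rho> x"
proof -
  interpret wo_rel w using wo by (simp add: wo_rel_def)
  show ?thesis using le
  proof (induction \<tau> arbitrary: x rule: well_order_induct)
    case (1 \<tau>)
    show ?case
    proof (cases "\<rho> = \<tau>")
      case False
      with 1 have \<rho>: "\<rho> \<in> underS \<tau>" by (simp add: underS_def)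
      show ?thesis
      proof (cases "\<exists>\<upsilon>. is_successor w \<upsilon> \<tau>")
        case True
        then obtain \<upsilon> where \<upsilon>: "is_successor w \<upsilon> \<tau>" ..
        with \<rho> have "(\<rho>, \<upsilon>) \<in> w" "\<upsilon> \<noteq> \<tau>" "(\<upsilon>, \<tau>) \<in> w"
          by (auto simp: is_successor_def underS_def under_def)
        with 1 have "image_stage w C \<upsilon> x \<subseteq> image_stage w C \<rho> x" by blast
        then show ?thesis
          using image_stage_shift[OF wo cl, of x \<upsilon>] image_stage_successor[OF wo \<upsilon>, of C x] by simp
      next
        case False
        with \<rho> show ?thesis by (subst image_stage_unfold[OF wo]) auto
      qed
    qed simp
  qed
qed

lemma stable_image_exists:
  fixes C :: "('r, 'd, 'e) couple" and x :: "int \<times> int"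
  assumes cl: "\<And>x. imap C x ` carrier (Dob C x) \<subseteq> carrier (Dob C (x + deg_i C))"
  shows "\<exists>!S. \<exists>\<tau>\<^sub>0. \<forall>\<tau>. (\<tau>\<^sub>0, \<tau>) \<in> (filtration_ordinals :: (int \<times> int \<times> 'd) set rel) \<longrightarrow>
     image_stage filtration_ordinals C \<tau> x = S"
proof -
  define w where "w = (filtration_ordinals :: (int \<times> int \<times> 'd) set rel)"
  have card: "Card_order w"
    unfolding w_def filtration_ordinals_def by (rule card_of_Card_order)
  have fld: "Field w = UNIV"
    unfolding w_def filtration_ordinals_def by (rule Field_card_of)
  from card have wo: "Well_order w" by (metis card_order_on_well_order_on)
  interpret wo_rel w using wo by (simp add: wo_rel_def)
  let ?I = "image_stage w C"
  have "infinite (UNIV :: (int \<times> int \<times> 'd) set)"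
    by (simp add: finite_prod infinite_UNIV_char_0)
  then have inf: "\<not> finite (Field w)" by (simp add: fld Finite_Set.finite_set)
  have ex: "\<exists>\<tau>'. is_successor w \<tau> \<tau>'" for \<tau>
  proof -
    have "\<exists>b. \<tau> \<noteq> b \<and> (\<tau>, b) \<in> w"
      using infinite_Card_order_limit[OF card inf, of \<tau>] fld by auto
    then have "\<exists>m. (\<tau> \<noteq> m \<and> (\<tau>, m) \<in> w) \<and> (\<forall>b. (\<tau> \<noteq> b \<and> (\<tau>, b) \<in> w) \<longrightarrow> (b, m) \<notin> w - Id)"
      using WF by (auto simp: wf_eq_minimal elim!: allE[of _ "{b. \<tau> \<noteq> b \<and> (\<tau>, b) \<in> w}"])
    then obtain m where m: "\<tau> \<noteq> m" "(\<tau>, m) \<in> w"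
      and least: "\<And>b. \<tau> \<noteq> b \<Longrightarrow> (\<tau>, b) \<in> w \<Longrightarrow> (b, m) \<notin> w - Id" by blast
    have tot: "(p, q) \<in> w \<or> (q, p) \<in> w" for p q using TOTALS fld by auto
    have "underS m = under \<tau>"
    proof (intro equalityI subsetI)
      fix p assume "p \<in> underS m"
      then have "(p, m) \<in> w - Id" by (auto simp: underS_def)
      with least[of p] have "\<tau> = p \<or> (\<tau>, p) \<notin> w" by blast
      with tot[of \<tau> p] tot[of \<tau> \<tau>] show "p \<in> under \<tau>" by (auto simp: under_def)
    next
      fix p assume "p \<in> under \<tau>"
      then have p: "(p, \<tau>) \<in> w" by (simp add: under_def)
      with m TRANS have "(p, m) \<in> w" by (blast dest: transD)
      moreover have "p \<noteq> m" using p m ANTISYM by (auto simp: antisym_def)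
      ultimately show "p \<in> underS m" by (simp add: underS_def)
    qed
    with m show ?thesis by (auto simp: is_successor_def underS_def)
  qed
  then obtain nxt where nxt: "\<And>\<tau>. is_successor w \<tau> (nxt \<tau>)" by metis
  have nxt_ge: "(\<tau>, nxt \<tau>) \<in> w" for \<tau> using nxt[of \<tau>] by (simp add: is_successor_def underS_def)
  have nxt_le: "(nxt \<tau>, \<upsilon>) \<in> w" if "(\<tau>, \<upsilon>) \<in> w" "\<tau> \<noteq> \<upsilon>" for \<tau> \<upsilon>
  proof (rule ccontr)
    assume "(nxt \<tau>, \<upsilon>) \<notin> w"
    then have "(\<upsilon>, nxt \<tau>) \<in> w" "\<upsilon> \<noteq> nxt \<tau>" using TOTALS fld by auto
    then have "(\<upsilon>, \<tau>) \<in> w" using nxt[of \<tau>] by (auto simp: is_successor_def underS_def under_def)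
    with that show False using ANTISYM by (auto simp: antisym_def)
  qed
  have anti: "?I \<tau> y \<subseteq> ?I \<rho> y" if "(\<rho>, \<tau>) \<in> w" for \<rho> \<tau> y
    by (rule image_stage_antimono[OF wo cl that])
  have "\<exists>\<tau>. ?I (nxt \<tau>) = ?I \<tau>"
  proof (rule ccontr)
    assume "\<not> ?thesis"
    then have "\<exists>y d. d \<in> ?I \<tau> y \<and> d \<notin> ?I (nxt \<tau>) y" for \<tau>
      using anti[OF nxt_ge[of \<tau>]] by (meson ext subsetI subset_antisym)
    then have "\<exists>p. snd (snd p) \<in> ?I \<tau> (fst p, fst (snd p)) \<and>
        snd (snd p) \<notin> ?I (nxt \<tau>) (fst p, fst (snd p))" for \<tau>
      by (metis fst_conv snd_conv surj_pair)
    then obtain g where g: "\<And>\<tau>. snd (snd (g \<tau>)) \<in> ?I \<tau> (fst (g \<tau>), fst (snd (g \<tau>)))"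
      "\<And>\<tau>. snd (snd (g \<tau>)) \<notin> ?I (nxt \<tau>) (fst (g \<tau>), fst (snd (g \<tau>)))" by metis
    have less: "g \<tau> \<noteq> g \<upsilon>" if "(\<tau>, \<upsilon>) \<in> w" "\<tau> \<noteq> \<upsilon>" for \<tau> \<upsilon>
      using anti[OF nxt_le[OF that]] g(1)[of \<upsilon>] g(2)[of \<tau>] by (metis subsetD)
    have "inj g"
    proof (rule injI, rule ccontr)
      fix \<tau> \<upsilon> assume "g \<tau> = g \<upsilon>" "\<tau> \<noteq> \<upsilon>"
      with less[of \<tau> \<upsilon>] less[of \<upsilon> \<tau>] show False using TOTALS fld by auto
    qed
    then have "surj (inv_into UNIV g)" by (rule inj_imp_surj_inv)
    then show False using Cantors_theorem[of "UNIV :: (int \<times> int \<times> 'd) set"] by auto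
  qed
  then obtain \<tau>\<^sub>0 where \<tau>\<^sub>0: "?I (nxt \<tau>\<^sub>0) = ?I \<tau>\<^sub>0" ..
  have fix0: "imap C (y - deg_i C) ` ?I \<tau>\<^sub>0 (y - deg_i C) = ?I \<tau>\<^sub>0 y" for y
    using image_stage_successor[OF wo nxt[of \<tau>\<^sub>0], of C y] \<tau>\<^sub>0 by simp
  have const: "?I \<tau> y = ?I \<tau>\<^sub>0 y" if "(\<tau>\<^sub>0, \<tau>) \<in> w" for \<tau> y
    using that
  proof (induction \<tau> arbitrary: y rule: well_order_induct)
    case (1 \<tau>)
    show ?case
    proof (cases "\<tau> = \<tau>\<^sub>0")
      case False
      with 1 have u: "\<tau>\<^sub>0 \<in> underS \<tau>" by (simp add: underS_def)
      show ?thesis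
      proof (cases "\<exists>\<upsilon>. is_successor w \<upsilon> \<tau>")
        case True
        then obtain \<upsilon> where \<upsilon>: "is_successor w \<upsilon> \<tau>" ..
        with u have "(\<tau>\<^sub>0, \<upsilon>) \<in> w" "\<upsilon> \<noteq> \<tau>" "(\<upsilon>, \<tau>) \<in> w"
          by (auto simp: is_successor_def underS_def under_def)
        with 1 have "?I \<upsilon> z = ?I \<tau>\<^sub>0 z" for z by blast
        then show ?thesis using fix0 by (simp add: image_stage_successor[OF wo \<upsilon>])
      next
        case False
        have "?I \<tau>\<^sub>0 y \<subseteq> ?I \<rho> y" if "\<rho> \<in> underS \<tau>" for \<rho>
        proof (cases "(\<tau>\<^sub>0, \<rho>) \<in> w")
          case True
          with 1 that have "?I \<rho> y = ?I \<tau>\<^sub>0 y" unfolding underS_def by blast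
          then show ?thesis by simp
        next
          case False
          then have "(\<rho>, \<tau>\<^sub>0) \<in> w" using TOTALS fld by auto
          then show ?thesis by (rule anti)
        qed
        then have "?I \<tau>\<^sub>0 y \<subseteq> ?I \<tau> y"
          using False u by (subst (2) image_stage_unfold[OF wo]) auto
        with anti[of \<tau>\<^sub>0 \<tau> y] 1 show ?thesis by blast
      qed
    qed simp
  qed
  have "\<exists>!S. \<exists>\<tau>\<^sub>0. \<forall>\<tau>. (\<tau>\<^sub>0, \<tau>) \<in> w \<longrightarrow> ?I \<tau> x = S"
  proof (rule ex1I)
    show "\<exists>\<tau>\<^sub>1. \<forall>\<tau>. (\<tau>\<^sub>1, \<tau>) \<in> w \<longrightarrow> ?I \<tau> x = ?I \<tau>\<^sub>0 x" using const by blast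
  next
    fix S assume "\<exists>\<tau>\<^sub>1. \<forall>\<tau>. (\<tau>\<^sub>1, \<tau>) \<in> w \<longrightarrow> ?I \<tau> x = S"
    then obtain \<tau>\<^sub>1 where *: "\<And>\<tau>. (\<tau>\<^sub>1, \<tau>) \<in> w \<Longrightarrow> ?I \<tau> x = S" by blast
    have tot: "(p, q) \<in> w \<or> (q, p) \<in> w" for p q using TOTALS fld by auto
    show "S = ?I \<tau>\<^sub>0 x"
      using tot[of \<tau>\<^sub>0 \<tau>\<^sub>1] tot[of \<tau>\<^sub>0 \<tau>\<^sub>0] tot[of \<tau>\<^sub>1 \<tau>\<^sub>1] * const by metis
  qed
  then show ?thesis by (simp add: w_def)
qed

definition E_stable :: "('r, 'd, 'e) couple \<Rightarrow> int \<times> int \<Rightarrow> ('r, 'e set) module" where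
  "E_stable C y = subquotient (Eob C y)
     {e \<in> carrier (Eob C y). kmap C y e \<in> stable_image C (y + deg_k C)}
     (boundaries_inf C y)"

definition is_stable :: "('r, 'd, 'e) couple \<Rightarrow> int \<times> int \<Rightarrow> bool" where
  "is_stable C y \<longleftrightarrow> carrier (E_stable C y) = carrier (E_inf C y)"

end

theory Submission
  imports Defs
begin

text \<open>
  Write \<open>P r\<close> for the index \<open>x(n) + b + c + r a\<close> and let \<open>I\<close> denote the stable image, a submodule
  of \<open>D\<close>. Since \<open>x(n + \<sigma>) = x(n) + b + c\<close>, the limit in question is that of the modules at \<open>P r\<close>.
  An element \<open>v\<close> of it is a thread, \<open>i (v r) = v (r + 1)\<close> for all integers \<open>r\<close>.

  The transfinite construction of \<open>I\<close> matters only through its universal property: \<open>I\<close> is the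
  largest family of subsets of \<open>D\<close> each of whose members is an \<open>i\<close>-image of a member
  (\<open>stable_image_divisible\<close>, \<open>stable_image_greatest\<close>). The components of a thread form such a
  family, so threads have all their components in \<open>I\<close> (\<open>lim_in_stable_image\<close>); the same argument
  shows that \<open>I\<close> is closed under differences and that morphisms preserve it.

  The map \<open>k\<close> identifies the stable page modulo \<open>ker k\<close> with \<open>I \<inter> ker i\<close>. Because \<open>B\<^sup>\<infinity>\<close> lies in
  \<open>ker k\<close>, surjectivity of \<open>f\<close> on the stable limit pages gives surjectivity of \<open>f\<close> on \<open>I \<inter> ker i\<close>
  (\<open>stable_kernel_lift\<close>). There are exact sequences
  \<open>0 \<rightarrow> I \<inter> ker i \<rightarrow> I x \<rightarrow> I (x + a) \<rightarrow> 0\<close>, which \<open>f\<close> maps from \<open>C1\<close> to \<open>C2\<close>, and surjectivity on the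
  left allows a lift along \<open>f\<close> to be chosen compatibly with a given lift of the \<open>i\<close>-image
  (\<open>stable_image_step_lift\<close>).

  This step is used twice. In \<open>C2\<close> the colimit vanishes, so that every element of \<open>I (P r)\<close> is
  killed by some power of \<open>i\<close>; induction on that power makes \<open>f\<close> surjective on \<open>I (P r)\<close>. In
  particular \<open>v 0\<close> has a lift in \<open>I (P 0)\<close>. The images of this lift under \<open>i\<close> lift \<open>v r\<close> for positive
  \<open>r\<close>, and for negative \<open>r\<close> the step yields preimages under \<open>i\<close> that lift \<open>v r\<close>, one after the
  other. Together these form a thread over \<open>v\<close> (\<open>couple_lim_map_onto\<close>).
\<close>

(* Bidegrees are to be treated as vectors, not split into their two coordinates. *)
declare split_paired_All [simp del] split_paired_Ex [simp del]

section \<open>The stable image as the largest divisible family\<close>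

lemma well_order_filtration_ordinals: "Well_order filtration_ordinals"
  unfolding filtration_ordinals_def by (rule card_of_Well_order)

lemma filtration_ordinals_total:
  "(\<tau>, \<upsilon>) \<in> filtration_ordinals \<or> (\<upsilon>, \<tau>) \<in> filtration_ordinals"
proof -
  interpret wo_rel "filtration_ordinals"
    by (simp add: wo_rel_def well_order_filtration_ordinals)
  have "Field filtration_ordinals = UNIV"
    unfolding filtration_ordinals_def by (rule Field_card_of)
  then show ?thesis using TOTALS by blast
qed

text \<open>The well-order is an infinite cardinal, hence a limit ordinal: it has no last element.\<close>

lemma filtration_ordinals_successor:
  fixes \<tau> :: "(int \<times> int \<times> 'd) set"
  shows "\<exists>\<upsilon>. is_successor filtration_ordinals \<tau> \<upsilon>"
proof -
  define w where "w = (filtration_ordinals :: (int \<times> int \<times> 'd) set rel)"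
  have fld: "Field w = UNIV"
    unfolding w_def filtration_ordinals_def by (rule Field_card_of)
  interpret wo_rel w
    by (simp add: wo_rel_def w_def well_order_filtration_ordinals)
  have "infinite (UNIV :: (int \<times> int \<times> 'd) set)"
    by (simp add: finite_prod infinite_UNIV_char_0)
  then have "infinite (Field w)" by (simp add: fld Finite_Set.finite_set)
  moreover have "Card_order w"
    unfolding w_def filtration_ordinals_def by (rule card_of_Card_order)
  ultimately obtain \<mu> where "\<tau> \<noteq> \<mu>" "(\<tau>, \<mu>) \<in> w"
    using infinite_Card_order_limit[of w \<tau>] fld by auto
  then have "AboveS {\<tau>} \<noteq> {}" by (auto simp: AboveS_def fld)
  then have gr: "suc {\<tau>} \<noteq> \<tau>" "(\<tau>, suc {\<tau>}) \<in> w"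
    using suc_greater[of "{\<tau>}" \<tau>] fld by auto
  have least: "(suc {\<tau>}, \<rho>) \<in> w" if "\<rho> \<noteq> \<tau>" "(\<tau>, \<rho>) \<in> w" for \<rho>
    using that by (intro suc_least_AboveS) (auto simp: AboveS_def fld)
  have "\<rho> \<in> underS (suc {\<tau>}) \<longleftrightarrow> \<rho> \<in> under \<tau>" for \<rho>
  proof
    assume "\<rho> \<in> underS (suc {\<tau>})"
    then have \<rho>: "\<rho> \<noteq> suc {\<tau>}" "(\<rho>, suc {\<tau>}) \<in> w" by (simp_all add: underS_def)
    have "(suc {\<tau>}, \<rho>) \<notin> w"
      using \<rho> ANTISYM by (auto simp: antisym_def)
    with least[of \<rho>] have "\<rho> = \<tau> \<or> (\<tau>, \<rho>) \<notin> w" by blast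
    moreover have "(\<tau>, \<rho>) \<in> w \<or> (\<rho>, \<tau>) \<in> w" "(\<tau>, \<tau>) \<in> w"
      using TOTALS fld by auto
    ultimately show "\<rho> \<in> under \<tau>" by (auto simp: under_def)
  next
    assume "\<rho> \<in> under \<tau>"
    then have \<rho>: "(\<rho>, \<tau>) \<in> w" by (simp add: under_def)
    have "(\<rho>, suc {\<tau>}) \<in> w"
      using TRANS gr(2) \<rho> by (meson transD)
    moreover have "\<rho> \<noteq> suc {\<tau>}" using gr \<rho> ANTISYM by (auto simp: antisym_def)
    ultimately show "\<rho> \<in> underS (suc {\<tau>})" by (simp add: underS_def)
  qed
  with gr have "is_successor w \<tau> (suc {\<tau>})"
    by (auto simp: is_successor_def underS_def)
  then show ?thesis unfolding w_def by blast
qed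

lemma exact_couple_D_module:
  "exact_couple R C \<Longrightarrow> left_module R (Dob C x)"
  by (simp add: exact_couple_def Let_def)

lemma exact_couple_E_module:
  "exact_couple R C \<Longrightarrow> left_module R (Eob C x)"
  by (simp add: exact_couple_def Let_def)

lemma linear_map_abelian_group_hom:
  assumes "left_module R M" "left_module R N" "h \<in> linear_maps R M N"
  shows "abelian_group_hom M N h"
proof -
  interpret M: left_module R M by fact
  interpret N: left_module R N by fact
  show ?thesis
    using assms(3)
    by (intro abelian_group_homI M.abelian_group_axioms N.abelian_group_axioms group_hom.intro
        group_hom_axioms.intro M.a_group N.a_group) (auto simp: linear_maps_def hom_def)
qed

lemma (in abelian_group_hom) hom_minus:
  "\<lbrakk>x \<in> carrier G; y \<in> carrier G\<rbrakk> \<Longrightarrow> h (x \<ominus>\<^bsub>G\<^esub> y) = h x \<ominus>\<^bsub>H\<^esub> h y"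
  by (simp add: a_minus_def)

lemma (in abelian_group) minus_minus_cancel:
  "\<lbrakk>x \<in> carrier G; y \<in> carrier G\<rbrakk> \<Longrightarrow> x \<ominus> (x \<ominus> y) = y"
  by (simp add: a_minus_def minus_add a_assoc[symmetric] r_neg)

lemma exact_couple_i_hom:
  "exact_couple R C \<Longrightarrow> abelian_group_hom (Dob C x) (Dob C (x + deg_i C)) (imap C x)"
  by (rule linear_map_abelian_group_hom[of R])
    (simp_all add: exact_couple_def Let_def)

lemma exact_couple_j_hom:
  "exact_couple R C \<Longrightarrow> abelian_group_hom (Dob C x) (Eob C (x + deg_j C)) (jmap C x)"
  by (rule linear_map_abelian_group_hom[of R])
    (simp_all add: exact_couple_def Let_def)

lemma exact_couple_k_hom:
  "exact_couple R C \<Longrightarrow> abelian_group_hom (Eob C x) (Dob C (x + deg_k C)) (kmap C x)"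
  by (rule linear_map_abelian_group_hom[of R])
    (simp_all add: exact_couple_def Let_def)

lemma exact_couple_i_image:
  assumes "exact_couple R C"
  shows "imap C x ` carrier (Dob C x) \<subseteq> carrier (Dob C (x + deg_i C))"
proof -
  interpret i: abelian_group_hom "Dob C x" "Dob C (x + deg_i C)" "imap C x"
    by (rule exact_couple_i_hom[OF assms])
  show ?thesis by auto
qed

lemma stable_image_eventually:
  fixes C :: "('r, 'd, 'e) couple"
  assumes "exact_couple R C"
  obtains \<tau>0 where "\<And>\<tau>. (\<tau>0, \<tau>) \<in> (filtration_ordinals :: (int \<times> int \<times> 'd) set rel) \<Longrightarrow>
    image_stage filtration_ordinals C \<tau> x = stable_image C x"
proof -
  have "\<exists>\<tau>0. \<forall>\<tau>. (\<tau>0, \<tau>) \<in> (filtration_ordinals :: (int \<times> int \<times> 'd) set rel) \<longrightarrow>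
      image_stage filtration_ordinals C \<tau> x = stable_image C x"
    unfolding stable_image_def
    by (rule theI'[OF stable_image_exists[OF exact_couple_i_image[OF assms]]])
  then obtain \<tau>0 where "\<forall>\<tau>. (\<tau>0, \<tau>) \<in> (filtration_ordinals :: (int \<times> int \<times> 'd) set rel) \<longrightarrow>
      image_stage filtration_ordinals C \<tau> x = stable_image C x" ..
  then show ?thesis using that[of \<tau>0] by simp
qed

text \<open>Far enough out, a stage and its successor both equal the stable image.\<close>

lemma stable_image_divisible:
  fixes C :: "('r, 'd, 'e) couple"
  assumes "exact_couple R C"
  shows "stable_image C x = imap C (x - deg_i C) ` stable_image C (x - deg_i C)"
proof -
  let ?w = "filtration_ordinals :: (int \<times> int \<times> 'd) set rel"
  interpret wo_rel ?w by (simp add: wo_rel_def well_order_filtration_ordinals)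
  obtain \<tau>1 where \<tau>1: "\<And>\<tau>. (\<tau>1, \<tau>) \<in> ?w \<Longrightarrow> image_stage ?w C \<tau> x = stable_image C x"
    using stable_image_eventually[OF assms] by blast
  obtain \<tau>2 where \<tau>2: "\<And>\<tau>. (\<tau>2, \<tau>) \<in> ?w \<Longrightarrow>
      image_stage ?w C \<tau> (x - deg_i C) = stable_image C (x - deg_i C)"
    using stable_image_eventually[OF assms] by blast
  obtain \<tau> where \<tau>: "(\<tau>1, \<tau>) \<in> ?w" "(\<tau>2, \<tau>) \<in> ?w"
    using filtration_ordinals_total by metis
  obtain \<upsilon> where \<upsilon>: "is_successor ?w \<tau> \<upsilon>" using filtration_ordinals_successor by blast
  then have "(\<tau>, \<upsilon>) \<in> ?w" by (simp add: is_successor_def underS_def)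
  with \<tau>(1) have "(\<tau>1, \<upsilon>) \<in> ?w" using TRANS by (meson transD)
  then show ?thesis
    using image_stage_successor[OF well_order_filtration_ordinals \<upsilon>, of C x] \<tau>1 \<tau>2 \<tau> by simp
qed

text \<open>By transfinite induction a divisible family is contained in every stage of the filtration: it
  passes to successor stages by divisibility and to limit stages trivially.\<close>

lemma stable_image_greatest:
  fixes C :: "('r, 'd, 'e) couple"
  assumes "exact_couple R C"
    and car: "\<And>x. F x \<subseteq> carrier (Dob C x)"
    and div: "\<And>x. F x \<subseteq> imap C (x - deg_i C) ` F (x - deg_i C)"
  shows "F x \<subseteq> stable_image C x"
proof -
  let ?w = "filtration_ordinals :: (int \<times> int \<times> 'd) set rel"
  note wo = well_order_filtration_ordinals
  interpret wo_rel ?w by (simp add: wo_rel_def wo)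
  have "F x \<subseteq> image_stage ?w C \<tau> x" for \<tau>
  proof (induction \<tau> arbitrary: x rule: well_order_induct)
    case (1 \<tau>)
    show ?case
    proof (cases "\<exists>\<rho>. is_successor ?w \<rho> \<tau>")
      case True
      then obtain \<rho> where \<rho>: "is_successor ?w \<rho> \<tau>" ..
      then have "F (x - deg_i C) \<subseteq> image_stage ?w C \<rho> (x - deg_i C)"
        using 1 by (auto simp: is_successor_def underS_def)
      then show ?thesis
        using div[of x] unfolding image_stage_successor[OF wo \<rho>] by blast
    next
      case False
      have "F x \<subseteq> image_stage ?w C \<rho> x" if "\<rho> \<in> underS \<tau>" for \<rho>
        using 1 that by (auto simp: underS_def)
      with False car[of x] show ?thesis
        by (subst image_stage_unfold[OF wo]) auto
    qed
  qed
  moreover obtain \<tau>0 where "\<And>\<tau>. (\<tau>0, \<tau>) \<in> ?w \<Longrightarrow> image_stage ?w C \<tau> x = stable_image C x"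
    using stable_image_eventually[OF assms(1)] by blast
  then have "image_stage ?w C \<tau>0 x = stable_image C x"
    using filtration_ordinals_total by blast
  ultimately show ?thesis by metis
qed

lemma stable_image_subset:
  fixes C :: "('r, 'd, 'e) couple"
  assumes "exact_couple R C"
  shows "stable_image C x \<subseteq> carrier (Dob C x)"
proof -
  let ?w = "filtration_ordinals :: (int \<times> int \<times> 'd) set rel"
  note wo = well_order_filtration_ordinals
  interpret wo_rel ?w by (simp add: wo_rel_def wo)
  obtain \<tau>0 where \<tau>0: "\<And>\<tau>. (\<tau>0, \<tau>) \<in> ?w \<Longrightarrow> image_stage ?w C \<tau> x = stable_image C x"
    using stable_image_eventually[OF assms(1)] by blast
  have "Field ?w = UNIV"
    unfolding filtration_ordinals_def by (rule Field_card_of)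
  then have min: "(minim UNIV, \<tau>) \<in> ?w" for \<tau>
    using minim_least[of UNIV \<tau>] by simp
  then have "underS (minim UNIV) = {}"
    using ANTISYM by (auto simp: underS_def antisym_def)
  then have "image_stage ?w C (minim UNIV) x = carrier (Dob C x)"
    by (simp add: image_stage_unfold[OF wo])
  moreover have "image_stage ?w C \<tau>0 x \<subseteq> image_stage ?w C (minim UNIV) x"
    by (rule image_stage_antimono[OF wo exact_couple_i_image[OF assms] min])
  ultimately show ?thesis using \<tau>0 filtration_ordinals_total by blast
qed

text \<open>The differences of elements of the stable image again form a divisible family.\<close>

lemma stable_image_minus:
  assumes C: "exact_couple R C"
    and "d \<in> stable_image C x" "d' \<in> stable_image C x"
  shows "d \<ominus>\<^bsub>Dob C x\<^esub> d' \<in> stable_image C x"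
proof -
  define F where "F x = {d \<ominus>\<^bsub>Dob C x\<^esub> d' |d d'. d \<in> stable_image C x \<and> d' \<in> stable_image C x}" for x
  have car: "d \<in> carrier (Dob C x)" if "d \<in> stable_image C x" for d x
    using stable_image_subset[OF C] that by blast
  have "F x \<subseteq> stable_image C x"
  proof (rule stable_image_greatest[OF C])
    fix x
    interpret left_module R "Dob C x" by (rule exact_couple_D_module[OF C])
    show "F x \<subseteq> carrier (Dob C x)" by (auto simp: F_def car)
  next
    fix x
    interpret i: abelian_group_hom "Dob C (x - deg_i C)" "Dob C x" "imap C (x - deg_i C)"
      using exact_couple_i_hom[OF C, of "x - deg_i C"] by simp
    show "F x \<subseteq> imap C (x - deg_i C) ` F (x - deg_i C)"
    proof
      fix z assume "z \<in> F x"
      then obtain d d' where z: "z = d \<ominus>\<^bsub>Dob C x\<^esub> d'" "d \<in> stable_image C x" "d' \<in> stable_image C x"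
        by (auto simp: F_def)
      with stable_image_divisible[OF C, of x] obtain e e' where
        e: "e \<in> stable_image C (x - deg_i C)" "e' \<in> stable_image C (x - deg_i C)"
          "d = imap C (x - deg_i C) e" "d' = imap C (x - deg_i C) e'" by auto
      then have "z = imap C (x - deg_i C) (e \<ominus>\<^bsub>Dob C (x - deg_i C)\<^esub> e')"
        by (simp add: z i.hom_minus car)
      with e show "z \<in> imap C (x - deg_i C) ` F (x - deg_i C)" by (auto simp: F_def)
    qed
  qed
  with assms show ?thesis by (auto simp: F_def)
qed

lemma couple_morphism_D_hom:
  assumes "exact_couple R C1" "exact_couple R C2" "couple_morphism R C1 C2 fD fE"
  shows "abelian_group_hom (Dob C1 x) (Dob C2 x) (fD x)"
  using assms
  by (intro linear_map_abelian_group_hom[of R] exact_couple_D_module)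
    (simp_all add: couple_morphism_def)

text \<open>The image of a divisible family under a morphism of couples is divisible.\<close>

lemma stable_image_morphism:
  assumes C1: "exact_couple R C1" and C2: "exact_couple R C2"
    and f: "couple_morphism R C1 C2 fD fE" and d: "d \<in> stable_image C1 x"
  shows "fD x d \<in> stable_image C2 x"
proof -
  have deg: "deg_i C2 = deg_i C1" using f by (simp add: couple_morphism_def)
  have "fD x ` stable_image C1 x \<subseteq> stable_image C2 x"
  proof (rule stable_image_greatest[OF C2, where F = "\<lambda>x. fD x ` stable_image C1 x"])
    fix x
    interpret f: abelian_group_hom "Dob C1 x" "Dob C2 x" "fD x"
      by (rule couple_morphism_D_hom[OF C1 C2 f])
    show "fD x ` stable_image C1 x \<subseteq> carrier (Dob C2 x)"
      using stable_image_subset[OF C1, of x] by auto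
  next
    fix x
    have "fD x (imap C1 (x - deg_i C1) e) = imap C2 (x - deg_i C1) (fD (x - deg_i C1) e)"
      if "e \<in> stable_image C1 (x - deg_i C1)" for e
    proof -
      have "\<forall>e\<in>carrier (Dob C1 (x - deg_i C1)).
          fD (x - deg_i C1 + deg_i C1) (imap C1 (x - deg_i C1) e)
            = imap C2 (x - deg_i C1) (fD (x - deg_i C1) e)"
        using f unfolding couple_morphism_def by blast
      then show ?thesis
        using stable_image_subset[OF C1, of "x - deg_i C1"] that by auto
    qed
    then show "fD x ` stable_image C1 x
        \<subseteq> imap C2 (x - deg_i C2) ` fD (x - deg_i C2) ` stable_image C1 (x - deg_i C2)"
      unfolding deg by (subst stable_image_divisible[OF C1, of x]) auto
  qed
  with d show ?thesis by blast
qed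

section \<open>Lifting kernel elements through the limit page\<close>

lemma zero_zmult [simp]: "0 \<cdot> v = 0"
  by (simp add: zmult_def zero_prod_def)

lemma zmult_add: "(m + m') \<cdot> v = m \<cdot> v + m' \<cdot> v"
  by (simp add: zmult_def algebra_simps plus_prod_def)

lemma one_zmult [simp]: "1 \<cdot> v = v"
  by (simp add: zmult_def)

text \<open>Boundaries are values of \<open>j\<close>, and \<open>k \<circ> j = 0\<close> by exactness.\<close>

lemma boundaries_inf_cycle:
  assumes C: "exact_couple R C" and e: "e \<in> boundaries_inf C y"
  shows "e \<in> carrier (Eob C y)" "kmap C y e = \<zero>\<^bsub>Dob C (y + deg_k C)\<^esub>"
proof -
  obtain d where d: "d \<in> carrier (Dob C (y - deg_j C))" "e = jmap C (y - deg_j C) d"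
    using e by (auto simp: boundaries_inf_def boundaries_def a_kernel_def')
  have "jmap C (y - deg_j C) ` carrier (Dob C (y - deg_j C))
      = a_kernel (Eob C (y - deg_j C + deg_j C)) (Dob C (y - deg_j C + deg_j C + deg_k C))
          (kmap C (y - deg_j C + deg_j C))"
    using C unfolding exact_couple_def Let_def by blast
  with d show "e \<in> carrier (Eob C y)" "kmap C y e = \<zero>\<^bsub>Dob C (y + deg_k C)\<^esub>"
    by (auto simp: a_kernel_def')
qed

lemma zero_in_boundaries_inf:
  assumes C: "exact_couple R C"
  shows "\<zero>\<^bsub>Eob C y\<^esub> \<in> boundaries_inf C y"
proof -
  interpret left_module R "Dob C (y - deg_j C)" by (rule exact_couple_D_module[OF C])
  interpret j: abelian_group_hom "Dob C (y - deg_j C)" "Eob C y" "jmap C (y - deg_j C)"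
    using exact_couple_j_hom[OF C, of "y - deg_j C"] by simp
  have "\<zero>\<^bsub>Dob C (y - deg_j C)\<^esub> \<in> a_kernel (Dob C (y - deg_j C))
      (Dob C (y - deg_j C + int 0 \<cdot> deg_i C)) (i_iter C 0 (y - deg_j C))"
    by (simp add: a_kernel_def' i_iter_def)
  then have "\<zero>\<^bsub>Eob C y\<^esub> \<in> boundaries C 0 y"
    unfolding boundaries_def by (intro image_eqI[where x = "\<zero>\<^bsub>Dob C (y - deg_j C)\<^esub>"]) simp_all
  then show ?thesis unfolding boundaries_inf_def by blast
qed

lemma kmap_boundary_coset:
  assumes C: "exact_couple R C" and z: "z \<in> carrier (Eob C y)"
    and e: "e \<in> boundaries_inf C y +>\<^bsub>Eob C y\<^esub> z"
  shows "kmap C y e = kmap C y z"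
proof -
  interpret k: abelian_group_hom "Eob C y" "Dob C (y + deg_k C)" "kmap C y"
    by (rule exact_couple_k_hom[OF C])
  obtain u where "u \<in> boundaries_inf C y" "e = u \<oplus>\<^bsub>Eob C y\<^esub> z"
    using e by (auto simp: a_r_coset_def')
  with z boundaries_inf_cycle[OF C] show ?thesis by auto
qed

lemma self_in_boundary_coset:
  assumes C: "exact_couple R C" and z: "z \<in> carrier (Eob C y)"
  shows "z \<in> boundaries_inf C y +>\<^bsub>Eob C y\<^esub> z"
proof -
  interpret left_module R "Eob C y" by (rule exact_couple_E_module[OF C])
  show ?thesis
    using zero_in_boundaries_inf[OF C, of y] z by (force simp: a_r_coset_def')
qed

text \<open>Stability is an equality of sets of cosets. It gives information on representatives since
  \<open>k\<close> is constant on each coset of the boundaries.\<close>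

lemma stable_imp_kmap_in_stable_image:
  assumes C: "exact_couple R C" and st: "is_stable C y" and e: "e \<in> (\<Inter>r. cycles C r y)"
  shows "kmap C y e \<in> stable_image C (y + deg_k C)"
proof -
  have car: "e \<in> carrier (Eob C y)" using e by (auto simp: cycles_def)
  have "boundaries_inf C y +>\<^bsub>Eob C y\<^esub> e \<in> carrier (E_inf C y)"
    using e by (simp add: E_inf_def subquotient_def)
  then obtain z where z: "z \<in> carrier (Eob C y)" "kmap C y z \<in> stable_image C (y + deg_k C)"
    and "boundaries_inf C y +>\<^bsub>Eob C y\<^esub> e = boundaries_inf C y +>\<^bsub>Eob C y\<^esub> z"
    using st by (auto simp: is_stable_def E_stable_def subquotient_def)
  then have "kmap C y e = kmap C y z"
    using kmap_boundary_coset[OF C z(1)] self_in_boundary_coset[OF C car] by simp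
  with z show ?thesis by simp
qed

text \<open>A transition map composes its steps at the far end; inductions below peel off the first step.\<close>

lemma transition_front:
  "transition t r (Suc k) d = transition t (r + 1) k (t r d)"
  by (induction k) (simp_all add: algebra_simps)

lemma stable_image_subset_i_iter:
  assumes C: "exact_couple R C" and d: "d \<in> stable_image C x"
  shows "d \<in> i_iter C m (x - int m \<cdot> deg_i C) ` carrier (Dob C (x - int m \<cdot> deg_i C))"
proof -
  have "\<exists>e\<in>stable_image C (x - int m \<cdot> deg_i C). i_iter C m (x - int m \<cdot> deg_i C) e = d"
  proof (induction m)
    case 0
    then show ?case using d by (simp add: i_iter_def)
  next
    case (Suc m)
    let ?x = "x - int m \<cdot> deg_i C"
    have x: "x - int (Suc m) \<cdot> deg_i C = ?x - deg_i C"
      by (simp add: zmult_add algebra_simps)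
    obtain e where e: "e \<in> stable_image C ?x" "i_iter C m ?x e = d" using Suc by blast
    obtain e' where e': "e' \<in> stable_image C (?x - deg_i C)" "imap C (?x - deg_i C) e' = e"
      using e(1) stable_image_divisible[OF C, of ?x] by auto
    \<comment> \<open>The remaining \<open>m\<close> steps out of \<open>?x - deg_i C\<close> are those of \<open>i_iter C m ?x\<close>, with indices shifted.\<close>
    have tr: "transition (\<lambda>s. imap C (?x - deg_i C + s \<cdot> deg_i C)) 1 k u
        = transition (\<lambda>s. imap C (?x + s \<cdot> deg_i C)) 0 k u" for k u
      by (induction k) (simp_all add: zmult_add algebra_simps)
    have "i_iter C (Suc m) (?x - deg_i C) e' = d"
      using e e' tr by (simp only: i_iter_def transition_front) simp
    with e' show ?case unfolding x by blast
  qed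
  then show ?thesis using stable_image_subset[OF C] by blast
qed

text \<open>An element of \<open>I \<inter> ker i\<close> is \<open>k e\<close> for some \<open>e\<close> by exactness, and \<open>e\<close> is a permanent cycle because the
  stable image lies in the image of every power of \<open>i\<close>. Lifting its class to the limit page of \<open>C1\<close>
  recovers \<open>e\<close> only up to boundaries, but \<open>k\<close> does not see these.\<close>

lemma stable_kernel_lift:
  assumes C1: "exact_couple R C1" and C2: "exact_couple R C2"
    and f: "couple_morphism R C1 C2 fD fE" and st: "is_stable C1 y"
    and epi: "E_inf_map C2 fE y \<in> module_epi R (E_inf C1 y) (E_inf C2 y)"
    and d: "d \<in> stable_image C2 (y + deg_k C2)"
    and id: "imap C2 (y + deg_k C2) d = \<zero>\<^bsub>Dob C2 (y + deg_k C2 + deg_i C2)\<^esub>"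
  shows "\<exists>u\<in>stable_image C1 (y + deg_k C1).
    imap C1 (y + deg_k C1) u = \<zero>\<^bsub>Dob C1 (y + deg_k C1 + deg_i C1)\<^esub> \<and> fD (y + deg_k C1) u = d"
proof -
  \<comment> \<open>The exactness axiom at \<open>E\<close>-index \<open>y\<close>, which the definition states for \<open>y = x + deg_j C\<close>.\<close>
  have ker: "kmap C y ` carrier (Eob C y)
      = a_kernel (Dob C (y + deg_k C)) (Dob C (y + deg_k C + deg_i C)) (imap C (y + deg_k C))"
    if "exact_couple R C" for C :: "('a, 'x, 'y) couple"
  proof -
    have "kmap C (y - deg_j C + deg_j C) ` carrier (Eob C (y - deg_j C + deg_j C))
      = a_kernel (Dob C (y - deg_j C + deg_j C + deg_k C))
          (Dob C (y - deg_j C + deg_i C + deg_j C + deg_k C))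
          (imap C (y - deg_j C + deg_j C + deg_k C))"
      using that unfolding exact_couple_def Let_def by blast
    then show ?thesis by (simp add: algebra_simps)
  qed
  have "d \<in> carrier (Dob C2 (y + deg_k C2))" using d stable_image_subset[OF C2] by blast
  with id have "d \<in> kmap C2 y ` carrier (Eob C2 y)"
    unfolding ker[OF C2] by (simp add: a_kernel_def')
  then obtain e where e: "e \<in> carrier (Eob C2 y)" "kmap C2 y e = d" by blast
  have "e \<in> (\<Inter>r. cycles C2 r y)"
    using e d stable_image_subset_i_iter[OF C2] by (auto simp: cycles_def)
  then have "boundaries_inf C2 y +>\<^bsub>Eob C2 y\<^esub> e \<in> carrier (E_inf C2 y)"
    by (simp add: E_inf_def subquotient_def)
  also have "carrier (E_inf C2 y) = E_inf_map C2 fE y ` carrier (E_inf C1 y)"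
    using epi by (simp add: module_epi_def)
  finally obtain e1 where e1: "e1 \<in> (\<Inter>r. cycles C1 r y)"
    and "boundaries_inf C2 y +>\<^bsub>Eob C2 y\<^esub> e = E_inf_map C2 fE y (boundaries_inf C1 y +>\<^bsub>Eob C1 y\<^esub> e1)"
    by (auto simp: E_inf_def subquotient_def)
  then have "e \<in> E_inf_map C2 fE y (boundaries_inf C1 y +>\<^bsub>Eob C1 y\<^esub> e1)"
    using self_in_boundary_coset[OF C2 e(1)] by simp
  then obtain z where z: "z \<in> boundaries_inf C1 y +>\<^bsub>Eob C1 y\<^esub> e1"
    and ez: "e \<in> boundaries_inf C2 y +>\<^bsub>Eob C2 y\<^esub> fE y z"
    by (auto simp: E_inf_map_def subquotient_map_def)
  interpret E1: left_module R "Eob C1 y" by (rule exact_couple_E_module[OF C1])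
  have e1c: "e1 \<in> carrier (Eob C1 y)" using e1 by (auto simp: cycles_def)
  then have zc: "z \<in> carrier (Eob C1 y)"
    using z boundaries_inf_cycle(1)[OF C1, of _ y] by (auto simp: a_r_coset_def')
  then have "fE y z \<in> carrier (Eob C2 y)"
    using f by (auto simp: couple_morphism_def linear_maps_def)
  then have "d = kmap C2 y (fE y z)"
    using kmap_boundary_coset[OF C2 _ ez] e by simp
  also have "\<dots> = fD (y + deg_k C1) (kmap C1 y z)"
    using f zc unfolding couple_morphism_def by metis
  also have "kmap C1 y z = kmap C1 y e1" by (rule kmap_boundary_coset[OF C1 e1c z])
  finally have "fD (y + deg_k C1) (kmap C1 y e1) = d" by simp
  moreover have "kmap C1 y e1 \<in> stable_image C1 (y + deg_k C1)"
    by (rule stable_imp_kmap_in_stable_image[OF C1 st e1])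
  moreover have "imap C1 (y + deg_k C1) (kmap C1 y e1) = \<zero>\<^bsub>Dob C1 (y + deg_k C1 + deg_i C1)\<^esub>"
    using ker[OF C1] e1c by (auto simp: a_kernel_def')
  ultimately show ?thesis by blast
qed

section \<open>Lifting threads\<close>

text \<open>The preimage \<open>w\<close> of \<open>u\<close> that divisibility provides lifts \<open>d\<close> up to an element of \<open>I \<inter> ker i\<close>. As this
  error lifts to \<open>I \<inter> ker i\<close> in \<open>C1\<close>, it can be subtracted from \<open>w\<close> without changing \<open>i w\<close>.\<close>

lemma stable_image_step_lift:
  assumes C1: "exact_couple R C1" and C2: "exact_couple R C2"
    and f: "couple_morphism R C1 C2 fD fE"
    and kernel_lift: "\<And>d. \<lbrakk>d \<in> stable_image C2 x; imap C2 x d = \<zero>\<^bsub>Dob C2 (x + deg_i C2)\<^esub>\<rbrakk> \<Longrightarrow>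
      \<exists>u\<in>stable_image C1 x. imap C1 x u = \<zero>\<^bsub>Dob C1 (x + deg_i C1)\<^esub> \<and> fD x u = d"
    and d: "d \<in> stable_image C2 x" and u: "u \<in> stable_image C1 (x + deg_i C1)"
    and fu: "fD (x + deg_i C1) u = imap C2 x d"
  shows "\<exists>v\<in>stable_image C1 x. imap C1 x v = u \<and> fD x v = d"
proof -
  have deg: "deg_i C2 = deg_i C1" using f by (simp add: couple_morphism_def)
  interpret i1: abelian_group_hom "Dob C1 x" "Dob C1 (x + deg_i C1)" "imap C1 x"
    by (rule exact_couple_i_hom[OF C1])
  interpret i2: abelian_group_hom "Dob C2 x" "Dob C2 (x + deg_i C1)" "imap C2 x"
    using exact_couple_i_hom[OF C2, of x] deg by simp
  interpret f: abelian_group_hom "Dob C1 x" "Dob C2 x" "fD x"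
    by (rule couple_morphism_D_hom[OF C1 C2 f])
  note car1 = stable_image_subset[OF C1, THEN subsetD]
  note car2 = stable_image_subset[OF C2, THEN subsetD]
  obtain w where w: "w \<in> stable_image C1 x" "imap C1 x w = u"
    using u stable_image_divisible[OF C1, of "x + deg_i C1"] by auto
  have fw: "fD x w \<in> stable_image C2 x" by (rule stable_image_morphism[OF C1 C2 f w(1)])
  let ?e = "fD x w \<ominus>\<^bsub>Dob C2 x\<^esub> d"
  have "imap C2 x (fD x w) = imap C2 x d"
    using f w fu car1[OF w(1)] unfolding couple_morphism_def by metis
  then have "imap C2 x ?e = \<zero>\<^bsub>Dob C2 (x + deg_i C2)\<^esub>"
    using car2[OF d] car2[OF fw] by (simp add: i2.hom_minus deg i2.H.r_neg a_minus_def)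
  then obtain v where v: "v \<in> stable_image C1 x" "imap C1 x v = \<zero>\<^bsub>Dob C1 (x + deg_i C1)\<^esub>" "fD x v = ?e"
    using kernel_lift stable_image_minus[OF C2 fw d] by blast
  have cars: "d \<in> carrier (Dob C2 x)" "w \<in> carrier (Dob C1 x)" "v \<in> carrier (Dob C1 x)"
    "u \<in> carrier (Dob C1 (x + deg_i C1))"
    using car1 car2 w v u d by auto
  have "imap C1 x (w \<ominus>\<^bsub>Dob C1 x\<^esub> v) = u"
    using cars w v by (simp add: i1.hom_minus) (simp add: a_minus_def)
  moreover have "fD x (w \<ominus>\<^bsub>Dob C1 x\<^esub> v) = d"
    using cars v(3)
    by (simp add: f.hom_minus i2.G.minus_minus_cancel)
  ultimately show ?thesis using stable_image_minus[OF C1 w(1) v(1)] by blast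
qed

text \<open>The class of \<open>d\<close> is that of the zero element at index \<open>0\<close>, so the two agree at some later index.\<close>

lemma colim_zero_imp_transition_zero:
  assumes zero: "zero_module (colim_module M t)"
    and hom: "\<And>r. abelian_group_hom (M r) (M (r + 1)) (t r)"
    and d: "d \<in> carrier (M r)"
  shows "\<exists>k. transition t r k d = \<zero>\<^bsub>M (r + int k)\<^esub>"
proof -
  have trz: "transition t s k \<zero>\<^bsub>M s\<^esub> = \<zero>\<^bsub>M (s + int k)\<^esub>" for s k
  proof (induction k)
    case (Suc k)
    interpret abelian_group_hom "M (s + int k)" "M (s + int k + 1)" "t (s + int k)" by (rule hom)
    show ?case using Suc hom_zero by (simp add: algebra_simps)
  qed simp
  have "colim_rel M t `` {(r, d)} \<in> carrier (colim_module M t)"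
    using d by (auto simp: colim_module_def quotient_def)
  then have "colim_rel M t `` {(r, d)} = colim_rel M t `` {(0, \<zero>\<^bsub>M 0\<^esub>)}"
    using zero by (simp add: zero_module_def) (simp add: colim_module_def)
  moreover have "((r, d), (r, d)) \<in> colim_rel M t"
    using d by (auto simp: colim_rel_def)
  ultimately have "((0, \<zero>\<^bsub>M 0\<^esub>), (r, d)) \<in> colim_rel M t" by blast
  then obtain k l where "0 + int k = r + int l" "transition t 0 k \<zero>\<^bsub>M 0\<^esub> = transition t r l d"
    by (auto simp: colim_rel_def)
  with trz[of 0 k] show ?thesis by (metis)
qed

lemma D_index_Suc: "base_point C m + (r + 1) \<cdot> deg_i C = base_point C m + r \<cdot> deg_i C + deg_i C"
  by (simp add: zmult_add algebra_simps)

lemma D_structure_hom: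
  "exact_couple R C \<Longrightarrow> abelian_group_hom (D_diagram C m r) (D_diagram C m (r + 1)) (D_structure C m r)"
  unfolding D_diagram_def D_structure_def D_index_Suc by (rule exact_couple_i_hom)

text \<open>The components of a thread, collected at each index, form a divisible family.\<close>

lemma lim_in_stable_image:
  assumes C: "exact_couple R C" and v: "v \<in> carrier (couple_lim C m)"
  shows "v r \<in> stable_image C (base_point C m + r \<cdot> deg_i C)"
proof -
  define F where "F x = {v r | r. x = base_point C m + r \<cdot> deg_i C}" for x
  have "F (base_point C m + r \<cdot> deg_i C) \<subseteq> stable_image C (base_point C m + r \<cdot> deg_i C)"
  proof (rule stable_image_greatest[OF C])
    show "F x \<subseteq> carrier (Dob C x)" for x
      using v by (auto simp: F_def couple_lim_def lim_module_def D_diagram_def)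
  next
    fix x show "F x \<subseteq> imap C (x - deg_i C) ` F (x - deg_i C)"
    proof
      fix z assume "z \<in> F x"
      then obtain r where z: "z = v r" "x = base_point C m + r \<cdot> deg_i C" by (auto simp: F_def)
      have x: "x - deg_i C = base_point C m + (r - 1) \<cdot> deg_i C"
        using D_index_Suc[of C m "r - 1"] z by simp
      have "D_structure C m (r - 1) (v (r - 1)) = v (r - 1 + 1)"
        using v by (simp add: couple_lim_def lim_module_def del: diff_add_cancel)
      then have "imap C (x - deg_i C) (v (r - 1)) = z"
        unfolding x by (simp add: D_structure_def z(1))
      moreover have "v (r - 1) \<in> F (x - deg_i C)" using x by (auto simp: F_def)
      ultimately show "z \<in> imap C (x - deg_i C) ` F (x - deg_i C)" by blast
    qed
  qed
  then show ?thesis by (auto simp: F_def)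
qed

text \<open>For positive indices the thread is forced by its value at \<open>0\<close>; for negative ones it is built
  downwards by dependent choice.\<close>

lemma int_thread_exists:
  fixes t :: "int \<Rightarrow> 'm \<Rightarrow> 'm"
  assumes start: "u0 \<in> S 0"
    and up: "\<And>r u. u \<in> S r \<Longrightarrow> t r u \<in> S (r + 1)"
    and down: "\<And>r u. u \<in> S (r + 1) \<Longrightarrow> \<exists>v\<in>S r. t r v = u"
  shows "\<exists>v. (\<forall>r. v r \<in> S r) \<and> (\<forall>r. t r (v r) = v (r + 1))"
proof -
  define p where "p = rec_nat u0 (\<lambda>k u. t (int k) u)"
  have p: "p 0 = u0" "\<And>k. p (Suc k) = t (int k) (p k)" by (simp_all add: p_def)
  have pS: "p k \<in> S (int k)" for k
  proof (induction k)
    case (Suc k)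
    with up[of "p k" "int k"] show ?case by (simp add: p add.commute)
  qed (simp add: p start)
  have "\<exists>q. \<forall>k. q k \<in> S (- int k) \<and> (k = 0 \<longrightarrow> q k = u0) \<and>
      t (- int (Suc k)) (q (Suc k)) = q k"
  proof -
    \<comment> \<open>The clause for \<open>k = 0\<close> makes the downward half start at the same element as the upward half.\<close>
    let ?P = "\<lambda>k x. x \<in> S (- int k) \<and> (k = 0 \<longrightarrow> x = u0)"
    have "\<exists>q. \<forall>k. ?P k (q k) \<and> t (- int (Suc k)) (q (Suc k)) = q k"
    proof (rule dependent_nat_choice[of ?P "\<lambda>k x y. t (- int (Suc k)) y = x"])
      show "\<exists>x. x \<in> S (- int 0) \<and> (0 = (0::nat) \<longrightarrow> x = u0)" using start by simp
    next
      fix x :: 'm and k :: nat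
      assume "x \<in> S (- int k) \<and> (k = 0 \<longrightarrow> x = u0)"
      then show "\<exists>y. (y \<in> S (- int (Suc k)) \<and> (Suc k = 0 \<longrightarrow> y = u0)) \<and> t (- int (Suc k)) y = x"
        using down[of x "- int (Suc k)"] by auto
    qed
    then show ?thesis by blast
  qed
  then obtain q where q: "\<And>k. q k \<in> S (- int k)" "q 0 = u0"
    "\<And>k. t (- int (Suc k)) (q (Suc k)) = q k" by blast
  define v where "v r = (if r \<ge> 0 then p (nat r) else q (nat (- r)))" for r
  have "v r \<in> S r" for r
    using pS[of "nat r"] q(1)[of "nat (- r)"] by (cases "r \<ge> 0") (simp_all add: v_def)
  moreover have "t r (v r) = v (r + 1)" for r
  proof (cases "r \<ge> 0")
    case True
    then have "v (r + 1) = p (Suc (nat r))" by (simp add: v_def nat_add_distrib)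
    with True show ?thesis by (simp add: v_def p)
  next
    case False
    define k where "k = nat (- r - 1)"
    with False have r: "r = - int (Suc k)" by simp
    then have "v r = q (Suc k)" "v (r + 1) = q k" by (auto simp: v_def p q nat_add_distrib)
    with r show ?thesis using q(3)[of k] by simp
  qed
  ultimately show ?thesis by blast
qed

text \<open>The lifts of \<open>v r\<close> in the stable image of \<open>C1\<close> form the sets \<open>S r\<close>. They are mapped onto each other by
  \<open>i\<close> because of the step lift, and \<open>S 0\<close> is nonempty because \<open>v 0\<close> dies in the colimit.\<close>

lemma couple_lim_map_onto:
  assumes C1: "exact_couple R C1" and C2: "exact_couple R C2"
    and f: "couple_morphism R C1 C2 fD fE"
    and base: "base_point C2 m = base_point C1 m"
    and kernel_lift: "\<And>r d. \<lbrakk>d \<in> stable_image C2 (base_point C1 m + r \<cdot> deg_i C1);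
        imap C2 (base_point C1 m + r \<cdot> deg_i C1) d
          = \<zero>\<^bsub>Dob C2 (base_point C1 m + r \<cdot> deg_i C1 + deg_i C2)\<^esub>\<rbrakk> \<Longrightarrow>
      \<exists>u\<in>stable_image C1 (base_point C1 m + r \<cdot> deg_i C1).
        imap C1 (base_point C1 m + r \<cdot> deg_i C1) u
          = \<zero>\<^bsub>Dob C1 (base_point C1 m + r \<cdot> deg_i C1 + deg_i C1)\<^esub> \<and>
        fD (base_point C1 m + r \<cdot> deg_i C1) u = d"
    and colim: "zero_module (couple_colim C2 m)"
    and v: "v \<in> carrier (couple_lim C2 m)"
  shows "v \<in> couple_lim_map C1 fD m ` carrier (couple_lim C1 m)"
proof -
  define P where "P r = base_point C1 m + r \<cdot> deg_i C1" for r
  have deg: "deg_i C2 = deg_i C1" using f by (simp add: couple_morphism_def)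
  have P_Suc: "P (r + 1) = P r + deg_i C1" for r unfolding P_def by (rule D_index_Suc)
  have D2: "D_diagram C2 m r = Dob C2 (P r)" "D_structure C2 m r = imap C2 (P r)" for r
    by (simp_all add: D_diagram_def D_structure_def P_def base deg)
  have D1: "D_diagram C1 m r = Dob C1 (P r)" "D_structure C1 m r = imap C1 (P r)" for r
    by (simp_all add: D_diagram_def D_structure_def P_def)
  have i_stable: "imap C (P r) d \<in> stable_image C (P (r + 1))"
    if "exact_couple R C" "deg_i C = deg_i C1" "d \<in> stable_image C (P r)"
    for C :: "('a, 'x, 'y) couple" and d r
    using stable_image_divisible[OF that(1), of "P (r + 1)"] that by (auto simp: P_Suc)
  note kl = kernel_lift[folded P_def]
  have step: "\<exists>w\<in>stable_image C1 (P r). imap C1 (P r) w = u \<and> fD (P r) w = d"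
    if "d \<in> stable_image C2 (P r)" "u \<in> stable_image C1 (P (r + 1))"
      "fD (P (r + 1)) u = imap C2 (P r) d" for d u r
    using stable_image_step_lift[OF C1 C2 f kl that(1) that(2,3)[unfolded P_Suc]] .
  \<comment> \<open>Induction on the power of \<open>i\<close> that kills \<open>d\<close>: lift \<open>i d\<close>, which dies one step earlier, then apply \<open>step\<close>.\<close>
  have onto: "\<exists>u\<in>stable_image C1 (P r). fD (P r) u = d"
    if "d \<in> stable_image C2 (P r)" "transition (D_structure C2 m) r k d = \<zero>\<^bsub>Dob C2 (P (r + int k))\<^esub>"
    for r k d
    using that
  proof (induction k arbitrary: r d)
    case 0
    then have d: "d = \<zero>\<^bsub>Dob C2 (P r)\<^esub>" by simp
    interpret i2: abelian_group_hom "Dob C2 (P r)" "Dob C2 (P r + deg_i C2)" "imap C2 (P r)"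
      by (rule exact_couple_i_hom[OF C2])
    have "imap C2 (P r) d = \<zero>\<^bsub>Dob C2 (P r + deg_i C2)\<^esub>" by (simp add: d)
    with 0 show ?case using kl[of d r] by blast
  next
    case (Suc k)
    have "transition (D_structure C2 m) (r + 1) k (imap C2 (P r) d)
        = \<zero>\<^bsub>Dob C2 (P (r + 1 + int k))\<^esub>"
      using Suc.prems(2) unfolding transition_front by (simp add: D2 algebra_simps)
    then obtain u where "u \<in> stable_image C1 (P (r + 1))" "fD (P (r + 1)) u = imap C2 (P r) d"
      using Suc.IH i_stable[OF C2 deg Suc.prems(1)] by blast
    then show ?case using step[OF Suc.prems(1)] by blast
  qed
  have v_car: "v r \<in> carrier (Dob C2 (P r))" and v_thread: "imap C2 (P r) (v r) = v (r + 1)" for r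
    using v by (simp_all add: couple_lim_def lim_module_def D2)
  have v_stable: "v r \<in> stable_image C2 (P r)" for r
    using lim_in_stable_image[OF C2 v, of r] by (simp add: P_def base deg)
  define S where "S r = {u \<in> stable_image C1 (P r). fD (P r) u = v r}" for r
  have "\<exists>k. transition (D_structure C2 m) 0 k (v 0) = \<zero>\<^bsub>D_diagram C2 m (0 + int k)\<^esub>"
    using v_car[of 0]
    by (intro colim_zero_imp_transition_zero D_structure_hom[OF C2] colim[unfolded couple_colim_def])
      (simp add: D2)
  then obtain k where "transition (D_structure C2 m) 0 k (v 0) = \<zero>\<^bsub>Dob C2 (P (0 + int k))\<^esub>"
    unfolding D2(1) ..
  then obtain u0 where "u0 \<in> S 0" using onto[OF v_stable] unfolding S_def by blast
  moreover have "imap C1 (P r) u \<in> S (r + 1)" if "u \<in> S r" for r u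
  proof -
    have u: "u \<in> stable_image C1 (P r)" "fD (P r) u = v r" using that by (simp_all add: S_def)
    then have "fD (P (r + 1)) (imap C1 (P r) u) = imap C2 (P r) (fD (P r) u)"
      using f stable_image_subset[OF C1] unfolding couple_morphism_def P_Suc by blast
    with u v_thread i_stable[OF C1 refl] show ?thesis by (simp add: S_def)
  qed
  moreover have "\<exists>w\<in>S r. imap C1 (P r) w = u" if "u \<in> S (r + 1)" for r u
    using that step[OF v_stable, of u r] v_thread by (auto simp: S_def)
  ultimately obtain u where u: "\<And>r. u r \<in> S r" "\<And>r. imap C1 (P r) (u r) = u (r + 1)"
    using int_thread_exists[of u0 S "\<lambda>r. imap C1 (P r)"] by blast
  have "u r \<in> carrier (Dob C1 (P r))" for r
    using u(1)[of r] stable_image_subset[OF C1, of "P r"] by (auto simp: S_def)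
  then have "u \<in> carrier (couple_lim C1 m)"
    using u(2) by (simp add: couple_lim_def lim_module_def D1)
  moreover have "couple_lim_map C1 fD m u = v"
    using u(1) by (auto simp: couple_lim_map_def P_def[symmetric] S_def)
  ultimately show ?thesis by blast
qed

lemma couple_lim_map_linear:
  assumes f: "couple_morphism R C1 C2 fD fE" and base: "base_point C2 m = base_point C1 m"
  shows "couple_lim_map C1 fD m \<in> linear_maps R (couple_lim C1 m) (couple_lim C2 m)"
proof -
  have deg: "deg_i C2 = deg_i C1" using f by (simp add: couple_morphism_def)
  have lin: "fD x \<in> linear_maps R (Dob C1 x) (Dob C2 x)" for x
    using f by (simp add: couple_morphism_def)
  have comm: "fD (base_point C1 m + (r + 1) \<cdot> deg_i C1) (imap C1 (base_point C1 m + r \<cdot> deg_i C1) d)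
      = imap C2 (base_point C1 m + r \<cdot> deg_i C1) (fD (base_point C1 m + r \<cdot> deg_i C1) d)"
    if "d \<in> carrier (Dob C1 (base_point C1 m + r \<cdot> deg_i C1))" for r d
    using f that unfolding couple_morphism_def D_index_Suc by blast
  have "couple_lim_map C1 fD m v \<in> carrier (couple_lim C2 m)"
    if v: "v \<in> carrier (couple_lim C1 m)" for v
  proof -
    have car: "v r \<in> carrier (Dob C1 (base_point C1 m + r \<cdot> deg_i C1))"
      and th: "imap C1 (base_point C1 m + r \<cdot> deg_i C1) (v r) = v (r + 1)" for r
      using v by (simp_all add: couple_lim_def lim_module_def D_diagram_def D_structure_def)
    have "fD (base_point C1 m + r \<cdot> deg_i C1) (v r) \<in> carrier (Dob C2 (base_point C1 m + r \<cdot> deg_i C1))"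
      for r
      using lin[of "base_point C1 m + r \<cdot> deg_i C1"] car[of r] by (auto simp: linear_maps_def)
    moreover have "imap C2 (base_point C1 m + r \<cdot> deg_i C1) (fD (base_point C1 m + r \<cdot> deg_i C1) (v r))
        = fD (base_point C1 m + (r + 1) \<cdot> deg_i C1) (v (r + 1))" for r
      using comm[OF car[of r]] by (simp add: th)
    ultimately show ?thesis
      by (simp add: couple_lim_def lim_module_def D_diagram_def D_structure_def couple_lim_map_def
          base deg)
  qed
  moreover have "fD x (d \<oplus>\<^bsub>Dob C1 x\<^esub> e) = fD x d \<oplus>\<^bsub>Dob C2 x\<^esub> fD x e"
    if "d \<in> carrier (Dob C1 x)" "e \<in> carrier (Dob C1 x)" for x d e
    using lin[of x] that by (simp add: linear_maps_def)
  moreover have "fD x (u \<odot>\<^bsub>Dob C1 x\<^esub> d) = u \<odot>\<^bsub>Dob C2 x\<^esub> fD x d"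
    if "u \<in> carrier R" "d \<in> carrier (Dob C1 x)" for x u d
    using lin[of x] that by (simp add: linear_maps_def)
  ultimately show ?thesis
    by (simp add: linear_maps_def Pi_def)
      (simp add: couple_lim_map_def couple_lim_def lim_module_def D_diagram_def base deg)
qed

text \<open>This is where regularity enters: the square of the sign is \<open>1\<close>.\<close>

lemma base_point_shift:
  assumes "couple_sign C \<in> {1, -1}"
  shows "base_point C (n + couple_sign C) = base_point C n + deg_j C + deg_k C"
  using assms by (auto simp: base_point_def zmult_def prod_eq_iff algebra_simps)

theorem proposition2p5p10:
  fixes R :: "('r, 'q) ring_scheme"
    and C1 :: "('r, 'd1, 'e1) couple" and C2 :: "('r, 'd2, 'e2) couple"
    and fD :: "int \<times> int \<Rightarrow> 'd1 \<Rightarrow> 'd2" and fE :: "int \<times> int \<Rightarrow> 'e1 \<Rightarrow> 'e2"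
    and a b c :: "int \<times> int" and \<sigma> n :: int
  assumes "regular_exact_couple R C1" and "regular_exact_couple R C2"
    and "couple_morphism R C1 C2 fD fE"
    and "a = deg_i C1" and "b = deg_j C1" and "c = deg_k C1"
    and "\<sigma> = det2 a (b + c)"
    and "\<And>r. is_stable C1 (base_point C1 n + b + r \<cdot> a)"
    and "\<And>r. is_stable C2 (base_point C2 n + b + r \<cdot> a)"
    and "\<And>r. E_inf_map C2 fE (base_point C1 n + b + r \<cdot> a)
           \<in> module_epi R (E_inf C1 (base_point C1 n + b + r \<cdot> a))
                          (E_inf C2 (base_point C1 n + b + r \<cdot> a))"
    and "zero_module (couple_colim C1 (n + \<sigma>))" and "zero_module (couple_colim C2 (n + \<sigma>))"
    and "\<And>r. dcc_module R
           ((Dob C1 (base_point C1 n + b + c + r \<cdot> a))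
              \<lparr>carrier := a_kernel (Dob C1 (base_point C1 n + b + c + r \<cdot> a))
                 (Dob C1 (base_point C1 n + b + c + (r + 1) \<cdot> a))
                 (imap C1 (base_point C1 n + b + c + r \<cdot> a))\<rparr>)"
  shows "couple_lim_map C1 fD (n + \<sigma>)
           \<in> module_epi R (couple_lim C1 (n + \<sigma>)) (couple_lim C2 (n + \<sigma>))"
proof -
  have C1: "exact_couple R C1" and C2: "exact_couple R C2"
    using assms(1,2) by (simp_all add: regular_exact_couple_def)
  note f = assms(3)
  have base2: "base_point C2 m = base_point C1 m" for m
    using f by (simp add: couple_morphism_def base_point_def couple_sign_def)
  have "\<sigma> = couple_sign C1" using assms(4-7) by (simp add: couple_sign_def)
  then have base: "base_point C1 (n + \<sigma>) = base_point C1 n + b + c"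
    using base_point_shift[of C1 n] assms(1)
    unfolding assms(5,6) regular_exact_couple_def by simp
  have "\<exists>u\<in>stable_image C1 (base_point C1 (n + \<sigma>) + r \<cdot> deg_i C1).
      imap C1 (base_point C1 (n + \<sigma>) + r \<cdot> deg_i C1) u
        = \<zero>\<^bsub>Dob C1 (base_point C1 (n + \<sigma>) + r \<cdot> deg_i C1 + deg_i C1)\<^esub> \<and>
      fD (base_point C1 (n + \<sigma>) + r \<cdot> deg_i C1) u = d"
    if "d \<in> stable_image C2 (base_point C1 (n + \<sigma>) + r \<cdot> deg_i C1)"
      "imap C2 (base_point C1 (n + \<sigma>) + r \<cdot> deg_i C1) d
        = \<zero>\<^bsub>Dob C2 (base_point C1 (n + \<sigma>) + r \<cdot> deg_i C1 + deg_i C2)\<^esub>" for r d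
  proof -
    let ?y = "base_point C1 n + b + r \<cdot> a"
    have x1: "base_point C1 (n + \<sigma>) + r \<cdot> deg_i C1 = ?y + deg_k C1"
      unfolding base assms(4,6) by (simp add: algebra_simps)
    moreover have "deg_k C2 = deg_k C1" using f by (simp add: couple_morphism_def)
    ultimately show ?thesis
      using stable_kernel_lift[OF C1 C2 f assms(8) assms(10)] that by metis
  qed
  then have "v \<in> couple_lim_map C1 fD (n + \<sigma>) ` carrier (couple_lim C1 (n + \<sigma>))"
    if "v \<in> carrier (couple_lim C2 (n + \<sigma>))" for v
    using couple_lim_map_onto[OF C1 C2 f base2 _ assms(12) that] by blast
  moreover have lin: "couple_lim_map C1 fD (n + \<sigma>)
      \<in> linear_maps R (couple_lim C1 (n + \<sigma>)) (couple_lim C2 (n + \<sigma>))"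
    by (rule couple_lim_map_linear[OF f base2])
  ultimately show ?thesis by (auto simp: module_epi_def linear_maps_def)
qed

end
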